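(* Let $G$ be any (not necessarily simple) graph on the vertex set $[0,n]$. Then for any reduction tree $\mathcal{R}$ of $G$, one has the equality of multisets $$\mathrm{LD}(G)=\mathrm{InSeq}(\mathcal{R}).$$
   Context: Notation: $[m,n]=\{m,m+1,\dots,n\}$, $[n]=[1,n]$. A graph on $[0,n]$ is a finite directed graph in which every edge is directed from its smaller endpoint to its larger endpoint; multiple edges are allowed and the copies of a multiple edge are regarded as distinct. $(i,j)$ with $i<j$ denotes an edge from $i$ to $j$. $\mathrm{indeg}_G(i)$ is the number of edges of $G$ whose larger endpoint is $i$. Reduction: let $G_0$ be a graph on $[0,n]$ with edges $(i,j)$ and $(j,k)$, $i<j<k$ (particular copies, if there are multiple edges). The reduction of $G_0$ on these edges (a reduction at vertex $j$) produces three graphs $G_1,G_2,G_3$ on $[0,n]$ with edge multisets $E(G_1)=E(G_0)\setminus\{(j,k)\}\cup\{(i,k)\}$, $E(G_2)=E(G_0)\setminus\{(i,j)\}\cup\{(i,k)\}$, $E(G_3)=E(G_0)\setminus\{(i,j),(j,k)\}\cup\{(i,k)\}$ (multiset unions). A reduction tree of $G$ is a rooted tree with nodes labeled by graphs: the root is labeled by $G$; each node that has children has exactly three children, labeled by the three graphs obtained from a single reduction on that node's graph; the process is continued until the graphs labeling the leaves admit no reduction. For a reduction tree $\mathcal{R}$ of a graph on $[0,n]$, $\mathrm{InSeq}(\mathcal{R})$ is the multiset of left-degree sequences $(\mathrm{indeg}_L(1),\dots,\mathrm{indeg}_L(n))$, one for each leaf $L$ of $\mathcal{R}$. The specific reduction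 tree $\mathcal{T}(G)$: let $G[0,i]$ be the restriction of $G$ to the vertices $[0,i]$, let $I_i$ be the multiset of edges of $G$ incoming to vertex $i$ (from smaller vertices), and let $V_i$ be the set of vertices $k$ with $(k,i)\in I_i$. $\mathcal{T}(G[0,1])$ is the single leaf $G[0,1]$. Given $\mathcal{T}(G[0,i])$, construct $\mathcal{T}(G[0,i+1])$ by appending the vertex $i+1$ and the edges $I_{i+1}$ to all graphs in $\mathcal{T}(G[0,i])$, and then, starting from each graph corresponding to a leaf of $\mathcal{T}(G[0,i])$, performing all possible reductions at each vertex of $V_{i+1}$ in the special reduction order, i.e. always performing a reduction on the longest edges possible incident to the vertex at which one is reducing (the length of an edge is the absolute value of the difference of its endpoint labels). Set $\mathcal{T}(G)=\mathcal{T}(G[0,n])$ and $\mathrm{LD}(G)=\mathrm{InSeq}(\mathcal{T}(G))$. *)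

theory Defs
  imports "HOL-Library.Multiset"
begin

(* A graph is its multiset of edges (smaller endpoint, larger endpoint); its vertex set
   {0..n} is recorded by the parameter n of graph_on, so isolated vertices cause no loss.
   Reducing on different copies of the same edges gives the same edge multisets, so copies
   need no names. *)
type_synonym graph = "(nat \<times> nat) multiset"

definition graph_on :: "nat \<Rightarrow> graph \<Rightarrow> bool" where
  "graph_on n G \<longleftrightarrow> (\<forall>(i, j) \<in># G. i < j \<and> j \<le> n)"

definition indeg :: "graph \<Rightarrow> nat \<Rightarrow> nat" where
  "indeg G i = size {#e \<in># G. snd e = i#}"

definition red1 :: "nat \<Rightarrow> nat \<Rightarrow> nat \<Rightarrow> graph \<Rightarrow> graph" where
  "red1 i j k G = G - {#(j, k)#} + {#(i, k)#}"

definition red2 :: "nat \<Rightarrow> nat \<Rightarrow> nat \<Rightarrow> graph \<Rightarrow> graph" where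
  "red2 i j k G = G - {#(i, j)#} + {#(i, k)#}"

definition red3 :: "nat \<Rightarrow> nat \<Rightarrow> nat \<Rightarrow> graph \<Rightarrow> graph" where
  "red3 i j k G = G - {#(i, j), (j, k)#} + {#(i, k)#}"

definition can_reduce :: "nat \<Rightarrow> nat \<Rightarrow> nat \<Rightarrow> graph \<Rightarrow> bool" where
  "can_reduce i j k G \<longleftrightarrow> i < j \<and> j < k \<and> (i, j) \<in># G \<and> (j, k) \<in># G"

datatype 'a rtree = Leaf 'a | Node 'a "'a rtree" "'a rtree" "'a rtree"

fun leaves :: "'a rtree \<Rightarrow> 'a multiset" where
  "leaves (Leaf a) = {#a#}"
| "leaves (Node a t1 t2 t3) = leaves t1 + leaves t2 + leaves t3"

inductive reduction_tree :: "graph \<Rightarrow> graph rtree \<Rightarrow> bool" where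
  leaf: "(\<And>i j k. \<not> can_reduce i j k G) \<Longrightarrow> reduction_tree G (Leaf G)"
| node: "can_reduce i j k G \<Longrightarrow> reduction_tree (red1 i j k G) t1 \<Longrightarrow>
    reduction_tree (red2 i j k G) t2 \<Longrightarrow> reduction_tree (red3 i j k G) t3 \<Longrightarrow>
    reduction_tree G (Node G t1 t2 t3)"

definition InSeq :: "nat \<Rightarrow> graph rtree \<Rightarrow> nat list multiset" where
  "InSeq n R = image_mset (\<lambda>L. map (indeg L) [1..<Suc n]) (leaves R)"

(* All possible reductions at j, always on the longest edges at j: the longest incoming edge
   has the smallest other endpoint, the longest outgoing edge the largest one. *)
function reduce_at :: "nat \<Rightarrow> graph \<Rightarrow> graph rtree" where
  "reduce_at j G =
    (if \<exists>i k. can_reduce i j k G then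
       let i = Min {i. i < j \<and> (i, j) \<in># G}; k = Max {k. j < k \<and> (j, k) \<in># G}
       in Node G (reduce_at j (red1 i j k G)) (reduce_at j (red2 i j k G)) (reduce_at j (red3 i j k G))
     else Leaf G)"
  by pat_completeness auto

lemma can_reduce_longest:
  assumes "\<exists>i k. can_reduce i j k G"
  shows "can_reduce (Min {i. i < j \<and> (i, j) \<in># G}) j (Max {k. j < k \<and> (j, k) \<in># G}) G"
proof -
  let ?A = "{i. i < j \<and> (i, j) \<in># G}" and ?B = "{k. j < k \<and> (j, k) \<in># G}"
  have "?A \<subseteq> fst ` set_mset G" "?B \<subseteq> snd ` set_mset G" by force+
  then have "finite ?A" "finite ?B" by (auto intro: finite_subset)
  moreover have "?A \<noteq> {}" "?B \<noteq> {}" using assms unfolding can_reduce_def by auto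
  ultimately have "Min ?A \<in> ?A" "Max ?B \<in> ?B" using Min_in Max_in by blast+
  then show ?thesis unfolding can_reduce_def by blast
qed

lemma can_reduce_incident_less:
  assumes "can_reduce i j k G"
  shows "size {#e \<in># red1 i j k G. fst e = j \<or> snd e = j#} < size {#e \<in># G. fst e = j \<or> snd e = j#}"
    and "size {#e \<in># red2 i j k G. fst e = j \<or> snd e = j#} < size {#e \<in># G. fst e = j \<or> snd e = j#}"
    and "size {#e \<in># red3 i j k G. fst e = j \<or> snd e = j#} < size {#e \<in># G. fst e = j \<or> snd e = j#}"
proof -
  have "i < j" "j < k" "(i, j) \<in># G" "(j, k) \<in># G" using assms unfolding can_reduce_def by auto
  moreover have "(i, j) \<noteq> (j, k)" using \<open>i < j\<close> by simp
  ultimately have "(j, k) \<in># G - {#(i, j)#}" by (metis insert_DiffM insert_noteq_member)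
  with \<open>(i, j) \<in># G\<close> obtain H where G: "G = add_mset (i, j) (add_mset (j, k) H)"
    by (metis insert_DiffM)
  show "size {#e \<in># red1 i j k G. fst e = j \<or> snd e = j#} < size {#e \<in># G. fst e = j \<or> snd e = j#}"
    and "size {#e \<in># red2 i j k G. fst e = j \<or> snd e = j#} < size {#e \<in># G. fst e = j \<or> snd e = j#}"
    and "size {#e \<in># red3 i j k G. fst e = j \<or> snd e = j#} < size {#e \<in># G. fst e = j \<or> snd e = j#}"
    using \<open>i < j\<close> \<open>j < k\<close> unfolding G red1_def red2_def red3_def by auto
qed

termination reduce_at
proof (relation "measure (\<lambda>(j, G). size {#e \<in># G. fst e = j \<or> snd e = j#})", goal_cases)
  case 1
  show ?case by simp
next
  case (2 j G i k)
  then show ?case using can_reduce_incident_less(1)[OF can_reduce_longest[OF 2(1)]] by simp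
next
  case (3 j G i k)
  then show ?case using can_reduce_incident_less(2)[OF can_reduce_longest[OF 3(1)]] by simp
next
  case (4 j G i k)
  then show ?case using can_reduce_incident_less(3)[OF can_reduce_longest[OF 4(1)]] by simp
qed

declare reduce_at.simps [simp del]

fun graft :: "('a \<Rightarrow> 'a rtree) \<Rightarrow> 'a rtree \<Rightarrow> 'a rtree" where
  "graft f (Leaf a) = f a"
| "graft f (Node a t1 t2 t3) = Node a (graft f t1) (graft f t2) (graft f t3)"

definition induced :: "graph \<Rightarrow> nat \<Rightarrow> graph" where
  "induced G i = {#e \<in># G. fst e \<le> i \<and> snd e \<le> i#}"

definition in_edges :: "graph \<Rightarrow> nat \<Rightarrow> graph" where
  "in_edges G i = {#e \<in># G. snd e = i#}"

definition in_vertices :: "graph \<Rightarrow> nat \<Rightarrow> nat set" where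
  "in_vertices G i = {k. (k, i) \<in># in_edges G i}"

(* special_tree ord G i is the special reduction tree of the restriction of G to {0..i}, where
   ord l lists the vertices of in_vertices G l in the order in which they are reduced at.
   Only the case i \<ge> 1 matters; for i = 0 the tree is the single edgeless leaf. *)
fun special_tree :: "(nat \<Rightarrow> nat list) \<Rightarrow> graph \<Rightarrow> nat \<Rightarrow> graph rtree" where
  "special_tree ord G 0 = Leaf (induced G 0)"
| "special_tree ord G (Suc 0) = Leaf (induced G (Suc 0))"
| "special_tree ord G (Suc (Suc i)) =
    fold (\<lambda>v. graft (reduce_at v)) (ord (Suc (Suc i)))
      (map_rtree (\<lambda>H. H + in_edges G (Suc (Suc i))) (special_tree ord G (Suc i)))"

definition LD :: "(nat \<Rightarrow> nat list) \<Rightarrow> nat \<Rightarrow> graph \<Rightarrow> nat list multiset" where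
  "LD ord n G = InSeq n (special_tree ord G n)"

end

(* Give an edge (i, j) the weight x_ij = T_j (T_i + 1) / (T_i - T_j).  Then
   x_ij x_jk = x_ik (x_ij + x_jk + 1), so the product of the edge weights of G is the sum of
   the corresponding products over the leaves of any reduction tree of G.  Expand in the region
   |T_0| >> |T_1| >> ...: the weight becomes T_j plus terms of negative degree in T_i.  In a leaf
   no source of an edge is also a target, so the product over a leaf is the monomial recording
   its indegrees plus terms with a negative exponent somewhere.  Hence the coefficients at the
   nonnegative exponents count the leaves with given indegrees, and they depend on G only. *)

theory Submission
  imports Defs "HOL-Library.Poly_Mapping" "HOL-Computational_Algebra.Formal_Power_Series"
begin

section \<open>Partial reduction trees\<close>

text \<open>Unlike in \<open>reduction_tree\<close>, a leaf may still be reducible. This covers the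
  intermediate stages of the special tree and is stable under grafting.\<close>

inductive partial_tree :: "graph \<Rightarrow> graph rtree \<Rightarrow> bool" where
  leaf: "partial_tree G (Leaf G)"
| node: "can_reduce i j k G \<Longrightarrow> partial_tree (red1 i j k G) t1 \<Longrightarrow>
    partial_tree (red2 i j k G) t2 \<Longrightarrow> partial_tree (red3 i j k G) t3 \<Longrightarrow>
    partial_tree G (Node G t1 t2 t3)"

definition irreducible_graph :: "graph \<Rightarrow> bool" where
  "irreducible_graph G \<longleftrightarrow> (\<forall>i j k. \<not> can_reduce i j k G)"

lemma reduction_tree_partial_tree:
  "reduction_tree G t \<Longrightarrow> partial_tree G t \<and> (\<forall>L \<in># leaves t. irreducible_graph L)"
  by (induction rule: reduction_tree.induct)
    (auto intro: partial_tree.intros simp: irreducible_graph_def)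

text \<open>Exposing the untouched edges \<open>H\<close> turns the multiset differences in the
  three reductions into plain insertions.\<close>

lemma can_reduceE:
  assumes "can_reduce i j k G"
  obtains H where "G = add_mset (i, j) (add_mset (j, k) H)" "i < j" "j < k"
    "red1 i j k G = add_mset (i, j) (add_mset (i, k) H)"
    "red2 i j k G = add_mset (j, k) (add_mset (i, k) H)"
    "red3 i j k G = add_mset (i, k) H"
proof -
  have *: "i < j" "j < k" "(i, j) \<in># G" "(j, k) \<in># G"
    using assms by (auto simp: can_reduce_def)
  then have "(j, k) \<in># G - {#(i, j)#}"
    by (metis insert_DiffM insert_noteq_member less_irrefl prod.inject)
  with * obtain H where "G = add_mset (i, j) (add_mset (j, k) H)"
    by (metis insert_DiffM)
  with * that show thesis
    by (auto simp: red1_def red2_def red3_def add_mset_commute)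
qed

lemma graph_on_red:
  assumes "graph_on n G" "can_reduce i j k G"
  shows "graph_on n (red1 i j k G)" "graph_on n (red2 i j k G)" "graph_on n (red3 i j k G)"
  using assms(2) by (rule can_reduceE; use assms(1) in \<open>force simp: graph_on_def\<close>)+

lemma partial_tree_graph_on:
  assumes "partial_tree G t" "graph_on n G" "L \<in># leaves t"
  shows "graph_on n L"
  using assms by (induction rule: partial_tree.induct) (auto dest: graph_on_red)

lemma partial_tree_graft:
  assumes "partial_tree G t" "\<And>L. L \<in># leaves t \<Longrightarrow> partial_tree L (f L)"
  shows "partial_tree G (graft f t)"
  using assms by (induction rule: partial_tree.induct) (auto intro: partial_tree.intros)

lemma leaves_graft: "set_mset (leaves (graft f t)) = (\<Union>L \<in> set_mset (leaves t). set_mset (leaves (f L)))"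
  by (induction t) auto

lemma leaves_map_rtree: "leaves (map_rtree f t) = image_mset f (leaves t)"
  by (induction t) auto

lemma partial_tree_add:
  assumes "partial_tree G t"
  shows "partial_tree (G + I) (map_rtree (\<lambda>H. H + I) t)"
  using assms
proof (induction rule: partial_tree.induct)
  case (node i j k G t1 t2 t3)
  from node.hyps(1) have c: "can_reduce i j k (G + I)"
    by (auto simp: can_reduce_def)
  \<comment> \<open>Only copies already present in \<open>G\<close> are removed, so the truncated
    multiset difference commutes with adding \<open>I\<close>.\<close>
  from node.hyps(1) have "red1 i j k (G + I) = red1 i j k G + I"
    "red2 i j k (G + I) = red2 i j k G + I" "red3 i j k (G + I) = red3 i j k G + I"
    by (rule can_reduceE; simp add: red1_def red2_def red3_def)+
  with node c show ?case
    by (auto intro: partial_tree.node)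
qed (auto intro: partial_tree.intros)

section \<open>The special reduction tree\<close>

lemma partial_tree_reduce_at: "partial_tree G (reduce_at j G)"
proof (induction j G rule: reduce_at.induct)
  case (1 j G)
  show ?case
  proof (cases "\<exists>i k. can_reduce i j k G")
    case True
    then show ?thesis
      using 1 can_reduce_longest[OF True]
      by (subst reduce_at.simps) (auto simp: Let_def intro: partial_tree.node)
  next
    case False
    then show ?thesis
      by (subst reduce_at.simps) (auto intro: partial_tree.leaf)
  qed
qed

lemma reduce_at_leaves_irreducible_at:
  "L \<in># leaves (reduce_at j G) \<Longrightarrow> \<not> can_reduce i j k L"
proof (induction j G rule: reduce_at.induct)
  case (1 j G)
  show ?case
  proof (cases "\<exists>i k. can_reduce i j k G")
    case True
    let ?i = "Min {i. i < j \<and> (i, j) \<in># G}" and ?k = "Max {k. j < k \<and> (j, k) \<in># G}"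
    have "reduce_at j G = Node G (reduce_at j (red1 ?i j ?k G))
        (reduce_at j (red2 ?i j ?k G)) (reduce_at j (red3 ?i j ?k G))"
      using True by (subst reduce_at.simps) (simp add: Let_def)
    then show ?thesis
      using 1(1-3)[OF True refl refl] 1(4) by auto
  next
    case False
    then show ?thesis
      using 1(4) by (subst (asm) reduce_at.simps) auto
  qed
qed

text \<open>The invariant while the edges into a new last vertex \<open>m\<close> are processed:
  \<open>U\<close> holds the vertices still to be reduced at.\<close>

definition reducible_only_at :: "nat \<Rightarrow> nat set \<Rightarrow> graph \<Rightarrow> bool" where
  "reducible_only_at m U G \<longleftrightarrow> (\<forall>i j k. can_reduce i j k G \<longrightarrow> k = m \<and> j \<in> U)"

text \<open>A new edge \<open>(i, m)\<close> replaces a path \<open>i, v, m\<close>, and \<open>i\<close> has no incoming edge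
  \<open>(a, i)\<close>: otherwise there would be a path \<open>a, i, v\<close> not ending in \<open>m\<close>.\<close>

lemma reducible_only_at_red:
  assumes "graph_on m G" "reducible_only_at m U G" "can_reduce i v k G"
    and "G' \<in> {red1 i v k G, red2 i v k G, red3 i v k G}"
  shows "reducible_only_at m U G'"
proof -
  have k: "k = m" and iv: "(i, v) \<in># G" "i < v" "v < k"
    using assms(2,3) by (auto simp: reducible_only_at_def can_reduce_def)
  have sub: "e \<in># G \<or> e = (i, m)" if "e \<in># G'" for e
    using assms(3) by (rule can_reduceE) (use assms(4) that k in auto)
  have no: "\<not> can_reduce a i v G" for a
    using assms(2) iv k by (auto simp: reducible_only_at_def)
  show ?thesis
    unfolding reducible_only_at_def
  proof (intro allI impI)
    fix a b c
    assume abc: "can_reduce a b c G'"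
    then have e: "a < b" "b < c" "(a, b) \<in># G \<or> (a, b) = (i, m)" "(b, c) \<in># G \<or> (b, c) = (i, m)"
      using sub by (auto simp: can_reduce_def)
    \<comment> \<open>If \<open>(a, b)\<close> were the new edge \<open>(i, m)\<close>, then
      \<open>c\<close> would exceed \<open>m\<close>.\<close>
    have "c \<le> m"
      using e(4) assms(1) by (auto simp: graph_on_def)
    then have ab: "(a, b) \<in># G"
      using e by auto
    have "(b, c) \<noteq> (i, m)"
      using no[of a] ab iv e(1) by (auto simp: can_reduce_def)
    then have "can_reduce a b c G"
      using e ab by (auto simp: can_reduce_def)
    then show "c = m \<and> b \<in> U"
      using assms(2) by (auto simp: reducible_only_at_def)
  qed
qed

lemma partial_tree_reducible_only_at:
  assumes "partial_tree G t" "graph_on m G" "reducible_only_at m U G" "L \<in># leaves t"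
  shows "reducible_only_at m U L"
  using assms
proof (induction rule: partial_tree.induct)
  case (node i j k G t1 t2 t3)
  then show ?case
    using reducible_only_at_red[OF node.prems(1,2) node.hyps(1)] graph_on_red[OF node.prems(1) node.hyps(1)]
    by auto
qed auto

text \<open>Each pass removes its vertex from the allowed set for good, because
  \<open>reducible_only_at\<close> survives all later reductions. When the list is exhausted, no
  reduction is left.\<close>

lemma fold_graft_reduce_at:
  assumes "partial_tree G t" "graph_on m G" "\<And>L. L \<in># leaves t \<Longrightarrow> reducible_only_at m (set vs) L"
  shows "partial_tree G (fold (\<lambda>v. graft (reduce_at v)) vs t) \<and>
    (\<forall>L \<in># leaves (fold (\<lambda>v. graft (reduce_at v)) vs t). irreducible_graph L)"
  using assms
proof (induction vs arbitrary: t)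
  case Nil
  then show ?case
    by (auto simp: reducible_only_at_def irreducible_graph_def)
next
  case (Cons v vs)
  let ?t = "graft (reduce_at v) t"
  have "partial_tree G ?t"
    by (intro partial_tree_graft Cons.prems partial_tree_reduce_at)
  moreover have "reducible_only_at m (set vs) L" if L: "L \<in># leaves ?t" for L
  proof -
    obtain K where K: "K \<in># leaves t" "L \<in># leaves (reduce_at v K)"
      using L by (auto simp: leaves_graft)
    have "reducible_only_at m (set (v # vs)) L"
      using partial_tree_reducible_only_at[OF partial_tree_reduce_at _ _ K(2)] K(1)
        Cons.prems partial_tree_graph_on by blast
    moreover have "\<not> can_reduce i v k L" for i k
      using reduce_at_leaves_irreducible_at[OF K(2)] .
    ultimately show ?thesis
      unfolding reducible_only_at_def by (metis set_ConsD)
  qed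
  ultimately show ?case
    using Cons.IH[of ?t] Cons.prems(2) by simp
qed

lemma graph_on_induced: "graph_on n G \<Longrightarrow> graph_on m (induced G m)"
  by (auto simp: graph_on_def induced_def)

text \<open>Edges point upwards, so within the larger vertex set an edge touching
  \<open>Suc m\<close> must enter it.\<close>

lemma induced_Suc:
  assumes "graph_on n G"
  shows "induced G (Suc m) = induced G m + in_edges G (Suc m)"
proof (rule multiset_eqI)
  fix e :: "nat \<times> nat"
  show "count (induced G (Suc m)) e = count (induced G m + in_edges G (Suc m)) e"
  proof (cases "e \<in># G")
    case True
    then have "fst e < snd e"
      using assms by (auto simp: graph_on_def)
    then show ?thesis
      by (auto simp: induced_def in_edges_def)
  next
    case False
    then have "count G e = 0"
      by (simp add: not_in_iff)
    then show ?thesis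
      by (auto simp: induced_def in_edges_def)
  qed
qed

lemma induced_self: "graph_on n G \<Longrightarrow> induced G n = G"
  unfolding induced_def graph_on_def by (subst filter_mset_eq_conv) auto

lemma special_tree_reduces:
  assumes "graph_on n G" "\<And>i. i \<in> {2..m} \<Longrightarrow> set (ord i) = in_vertices G i"
  shows "partial_tree (induced G m) (special_tree ord G m) \<and>
    (\<forall>L \<in># leaves (special_tree ord G m). irreducible_graph L)"
  using assms
proof (induction ord G m rule: special_tree.induct)
  case (1 ord G)
  then show ?case
    by (auto intro: partial_tree.leaf simp: irreducible_graph_def can_reduce_def induced_def)
next
  case (2 ord G)
  then show ?case
    by (auto intro: partial_tree.leaf simp: irreducible_graph_def can_reduce_def induced_def)
next
  case (3 ord G i)
  let ?m = "Suc (Suc i)" and ?t = "special_tree ord G (Suc i)"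
  let ?I = "in_edges G ?m"
  have IH: "partial_tree (induced G (Suc i)) ?t" "\<And>L. L \<in># leaves ?t \<Longrightarrow> irreducible_graph L"
    using 3 by auto
  have "partial_tree (induced G ?m) (map_rtree (\<lambda>H. H + ?I) ?t)"
    using partial_tree_add[OF IH(1)] induced_Suc[OF 3(2)] by metis
  moreover have "reducible_only_at ?m (set (ord ?m)) L"
    if L: "L \<in># leaves (map_rtree (\<lambda>H. H + ?I) ?t)" for L
  proof -
    obtain H where H: "L = H + ?I" "H \<in># leaves ?t"
      using L by (auto simp: leaves_map_rtree)
    have g: "graph_on (Suc i) H"
      using partial_tree_graph_on[OF IH(1) graph_on_induced[OF 3(2)] H(2)] .
    show ?thesis
      unfolding reducible_only_at_def
    proof (intro allI impI)
      fix a b c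
      assume abc: "can_reduce a b c L"
      show "c = ?m \<and> b \<in> set (ord ?m)"
      \<comment> \<open>If the second edge is old, the whole path lies in the irreducible graph
        \<open>H\<close>. Otherwise it is an appended edge, whose source is on the list
        \<open>ord ?m\<close>.\<close>
      proof (cases "(b, c) \<in># H")
        case True
        then have "b < ?m"
          using g by (auto simp: graph_on_def)
        then have "can_reduce a b c H"
          using abc True by (auto simp: can_reduce_def H(1) in_edges_def)
        then show ?thesis
          using IH(2)[OF H(2)] by (auto simp: irreducible_graph_def)
      next
        case False
        then show ?thesis
          using abc 3(3)[of ?m] by (auto simp: can_reduce_def H(1) in_edges_def in_vertices_def)
      qed
    qed
  qed
  ultimately show ?case
    unfolding special_tree.simps by (rule fold_graft_reduce_at[OF _ graph_on_induced[OF 3(2)]])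
qed

section \<open>Edge weights\<close>

text \<open>Laurent polynomials in variables \<open>t\<^sub>i\<close> are the coefficients of power series in \<open>z\<close>.
  Substituting \<open>T\<^sub>i = t\<^sub>i z^i\<close> makes \<open>T\<^sub>j / T\<^sub>i\<close> topologically nilpotent for \<open>i < j\<close>.\<close>

type_synonym exponent = "nat \<Rightarrow>\<^sub>0 int"
type_synonym weight = "(exponent \<Rightarrow>\<^sub>0 int) fps"

definition monomial :: "exponent \<Rightarrow> nat \<Rightarrow> weight" where
  "monomial d w = fps_const (Poly_Mapping.single d 1) * fps_X ^ w"

definition vert :: "nat \<Rightarrow> weight" where
  "vert i = monomial (Poly_Mapping.single i 1) i"

text \<open>This is \<open>T_j / T_i\<close> for \<open>i < j\<close>: the exponents of the
  \<open>t_i\<close> are integers, while the power of the series variable is a truncated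
  difference.\<close>

definition ratio :: "nat \<Rightarrow> nat \<Rightarrow> weight" where
  "ratio i j = monomial (Poly_Mapping.single j 1 - Poly_Mapping.single i 1) (j - i)"

text \<open>The geometric series \<open>1 / (1 - ratio i j)\<close>. The argument \<open>1\<close>
  is the inverse of the constant coefficient, since \<open>ratio i j\<close> has constant
  coefficient 0 for \<open>i < j\<close>.\<close>

definition geom :: "nat \<Rightarrow> nat \<Rightarrow> weight" where
  "geom i j = fps_right_inverse (1 - ratio i j) 1"

text \<open>Dividing numerator and denominator of \<open>T_j (T_i + 1) / (T_i - T_j)\<close> by
  \<open>T_i\<close> makes the denominator a unit among the power series.\<close>

definition edge_weight :: "nat \<Rightarrow> nat \<Rightarrow> weight" where
  "edge_weight i j = (vert j + ratio i j) * geom i j"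

definition graph_weight :: "graph \<Rightarrow> weight" where
  "graph_weight G = (\<Prod>e \<in># G. edge_weight (fst e) (snd e))"

lemma monomial_nth: "fps_nth (monomial d w) v = (if v = w then Poly_Mapping.single d 1 else 0)"
  by (simp add: monomial_def fps_X_power_iff)

lemma monomial_mult: "monomial d w * monomial d' w' = monomial (d + d') (w + w')"
proof -
  have "monomial d w * monomial d' w' =
    (fps_const (Poly_Mapping.single d 1) * fps_const (Poly_Mapping.single d' 1)) * (fps_X ^ w * fps_X ^ w')"
    unfolding monomial_def by (simp only: ac_simps)
  then show ?thesis
    by (simp add: monomial_def mult_single power_add)
qed

lemma monomial_0: "monomial 0 0 = 1"
  by (simp add: monomial_def)

lemma vert_ratio: "i < j \<Longrightarrow> vert j = ratio i j * vert i"
  by (simp add: vert_def ratio_def monomial_mult)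

lemma ratio_mult: "i < j \<Longrightarrow> j < k \<Longrightarrow> ratio i k = ratio i j * ratio j k"
  by (simp add: ratio_def monomial_mult)

lemma geom: "i < j \<Longrightarrow> (1 - ratio i j) * geom i j = 1"
  unfolding geom_def by (rule fps_right_inverse) (simp add: ratio_def monomial_nth)

text \<open>With \<open>T\<close> for \<open>vert\<close>, the weight of \<open>(i, j)\<close> is \<open>T\<^sub>j (T\<^sub>i + 1) / (T\<^sub>i - T\<^sub>j)\<close>, so
  \<open>1 + 1 / x\<close> is multiplicative along paths.\<close>

lemma edge_weight_reduction:
  assumes "i < j" "j < k"
  shows "edge_weight i j * edge_weight j k =
    edge_weight i k * (edge_weight i j + edge_weight j k + 1)"
proof -
  define T a b g1 g2 g3 where d: "T = vert i" "a = ratio i j" "b = ratio j k"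
    "g1 = geom i j" "g2 = geom j k" "g3 = geom i k"
  have h: "(1 - a) * g1 = 1" "(1 - b) * g2 = 1" "(1 - a * b) * g3 = 1"
    using geom[of i j] geom[of j k] geom[of i k] assms ratio_mult[of i j k] by (simp_all add: d)
  have "vert j = a * T" "vert k = a * b * T" "ratio i k = a * b"
    using vert_ratio[of i j] vert_ratio[of i k] assms ratio_mult[of i j k] by (simp_all add: d)
  then have w: "edge_weight i j = a * (T + 1) * g1" "edge_weight j k = b * (a * T + 1) * g2"
    "edge_weight i k = a * b * (T + 1) * g3"
    by (simp_all add: edge_weight_def d algebra_simps)
  \<comment> \<open>Factors equal to 1 bring the sum over the common denominator
    \<open>(1 - a) * (1 - b)\<close>; its numerator is then
    \<open>(1 - a * b) * (a * T + 1)\<close>.\<close>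
  have "a * (T + 1) * g1 + b * (a * T + 1) * g2 + 1 =
      a * (T + 1) * g1 * ((1 - b) * g2) + b * (a * T + 1) * g2 * ((1 - a) * g1) +
      ((1 - a) * g1) * ((1 - b) * g2)"
    by (simp add: h)
  also have "\<dots> = (1 - a * b) * ((a * T + 1) * g1 * g2)"
    by (simp add: algebra_simps)
  finally have "edge_weight i k * (edge_weight i j + edge_weight j k + 1) =
      a * b * (T + 1) * (((1 - a * b) * g3) * ((a * T + 1) * g1 * g2))"
    unfolding w by (simp only: ac_simps)
  then show ?thesis
    unfolding w h(3) by (simp only: ac_simps mult_1_left)
qed

lemma graph_weight_red:
  assumes "can_reduce i j k G"
  shows "graph_weight G =
    graph_weight (red1 i j k G) + graph_weight (red2 i j k G) + graph_weight (red3 i j k G)"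
  using assms
proof (rule can_reduceE)
  fix H
  assume *: "G = add_mset (i, j) (add_mset (j, k) H)" "i < j" "j < k"
    "red1 i j k G = add_mset (i, j) (add_mset (i, k) H)"
    "red2 i j k G = add_mset (j, k) (add_mset (i, k) H)"
    "red3 i j k G = add_mset (i, k) H"
  have "graph_weight G = (edge_weight i j * edge_weight j k) * graph_weight H"
    by (simp add: * graph_weight_def mult.assoc)
  then show ?thesis
    using edge_weight_reduction[OF *(2,3)]
    by (simp add: *(4-6) graph_weight_def algebra_simps)
qed

lemma graph_weight_leaves:
  "partial_tree G t \<Longrightarrow> (\<Sum>L \<in># leaves t. graph_weight L) = graph_weight G"
  by (induction rule: partial_tree.induct) (auto simp: graph_weight_red)

section \<open>Extraction of the indegrees\<close>

text \<open>Later \<open>S\<close> contains every source and no target of a leaf. Then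
  \<open>vert j\<close> has degree 0 at a target \<open>j\<close>, and \<open>ratio i j\<close> has
  degree -1 on an edge \<open>(i, j)\<close>.\<close>

definition src_degree :: "nat set \<Rightarrow> exponent \<Rightarrow> int" where
  "src_degree S d = (\<Sum>i \<in> S. Poly_Mapping.lookup d i)"

definition degree_below :: "nat set \<Rightarrow> int \<Rightarrow> weight \<Rightarrow> bool" where
  "degree_below S b f \<longleftrightarrow> (\<forall>w. \<forall>d \<in> Poly_Mapping.keys (fps_nth f w). src_degree S d \<le> b)"

lemma src_degree_add: "src_degree S (d + d') = src_degree S d + src_degree S d'"
  by (simp add: src_degree_def lookup_add sum.distrib)

lemma src_degree_diff: "src_degree S (d - d') = src_degree S d - src_degree S d'"
  by (simp add: src_degree_def lookup_minus sum_subtractf)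

lemma src_degree_single: "finite S \<or> j \<notin> S \<Longrightarrow> src_degree S (Poly_Mapping.single j c) = (if j \<in> S then c else 0)"
  by (cases "finite S") (auto simp: src_degree_def lookup_single when_def)

lemma degree_below_mono: "degree_below S b f \<Longrightarrow> b \<le> c \<Longrightarrow> degree_below S c f"
  by (force simp: degree_below_def)

lemma degree_below_add: "degree_below S b f \<Longrightarrow> degree_below S b g \<Longrightarrow> degree_below S b (f + g)"
  using keys_add by (fastforce simp: degree_below_def)

lemma degree_below_mult:
  assumes "degree_below S b f" "degree_below S c g"
  shows "degree_below S (b + c) (f * g)"
  unfolding degree_below_def
proof (intro allI ballI)
  fix w d
  assume "d \<in> Poly_Mapping.keys (fps_nth (f * g) w)"
  then obtain i where "d \<in> Poly_Mapping.keys (fps_nth f i * fps_nth g (w - i))"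
    using keys_sum by (fastforce simp: fps_mult_nth)
  then obtain d1 d2 where "d = d1 + d2" "d1 \<in> Poly_Mapping.keys (fps_nth f i)" "d2 \<in> Poly_Mapping.keys (fps_nth g (w - i))"
    using keys_mult by blast
  then show "src_degree S d \<le> b + c"
    using assms by (auto simp: degree_below_def src_degree_add intro!: add_mono)
qed

lemma degree_below_monomial: "src_degree S d \<le> b \<Longrightarrow> degree_below S b (monomial d w)"
  by (auto simp: degree_below_def monomial_nth)

lemma degree_below_vert: "j \<notin> S \<Longrightarrow> degree_below S 0 (vert j)"
  unfolding vert_def by (rule degree_below_monomial) (simp add: src_degree_single)

lemma degree_below_ratio: "finite S \<Longrightarrow> i \<in> S \<Longrightarrow> j \<notin> S \<Longrightarrow> degree_below S (- 1) (ratio i j)"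
  unfolding ratio_def
  by (rule degree_below_monomial) (simp add: src_degree_diff src_degree_single)

text \<open>With \<open>r = ratio i j\<close>, the series \<open>h = geom i j - 1\<close> satisfies
  \<open>h = r + r * h\<close>. As \<open>r\<close> has positive order \<open>j - i\<close>, a
  coefficient of \<open>r * h\<close> involves only earlier coefficients of \<open>h\<close>, which
  permits strong induction.\<close>

lemma degree_below_geom:
  assumes "finite S" "i \<in> S" "j \<notin> S" "i < j" shows "degree_below S (- 1) (geom i j - 1)"
proof -
  define h where "h = geom i j - 1"
  have h: "h = ratio i j + ratio i j * h"
    using geom[OF assms(4)] by (simp add: h_def algebra_simps)
  have "\<forall>d \<in> Poly_Mapping.keys (fps_nth h w). src_degree S d \<le> - 1" for w
  proof (induction w rule: less_induct)
    case (less w)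
    show ?case
    proof
      fix d assume d: "d \<in> Poly_Mapping.keys (fps_nth h w)"
      have "fps_nth h w = fps_nth (ratio i j) w + fps_nth (ratio i j * h) w"
        by (subst h) simp
      with d consider "d \<in> Poly_Mapping.keys (fps_nth (ratio i j) w)" | "d \<in> Poly_Mapping.keys (fps_nth (ratio i j * h) w)"
        using keys_add by fastforce
      then show "src_degree S d \<le> - 1"
      proof cases
        case 1
        then show ?thesis
          using degree_below_ratio[OF assms(1-3)] by (auto simp: degree_below_def)
      next
        case 2
        then obtain v where v: "v \<le> w" "d \<in> Poly_Mapping.keys (fps_nth (ratio i j) v * fps_nth h (w - v))"
          using keys_sum by (fastforce simp: fps_mult_nth)
        then obtain d1 d2 where dd: "d = d1 + d2" "d1 \<in> Poly_Mapping.keys (fps_nth (ratio i j) v)"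
            "d2 \<in> Poly_Mapping.keys (fps_nth h (w - v))"
          using keys_mult by blast
        then have "v = j - i"
          by (auto simp: ratio_def monomial_nth split: if_splits)
        then have "src_degree S d2 \<le> - 1"
          using less[of "w - v"] v(1) dd(3) assms(4) by auto
        moreover have "src_degree S d1 \<le> - 1"
          using degree_below_ratio[OF assms(1-3)] dd(2) by (auto simp: degree_below_def)
        ultimately show ?thesis
          by (simp add: dd(1) src_degree_add)
      qed
    qed
  qed
  then show ?thesis
    by (simp add: degree_below_def h_def)
qed

lemma edge_weight_leading:
  assumes "finite S" "i \<in> S" "j \<notin> S" "i < j"
  shows "degree_below S (- 1) (edge_weight i j - vert j)"
proof -
  let ?h = "geom i j - 1"
  have "edge_weight i j - vert j = (vert j * ?h + ratio i j) + ratio i j * ?h"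
    by (simp add: edge_weight_def algebra_simps)
  moreover have "degree_below S (- 1) (vert j * ?h)"
    using degree_below_mult[OF degree_below_vert[OF assms(3)] degree_below_geom[OF assms]] by simp
  moreover have "degree_below S (- 1) (ratio i j * ?h)"
    using degree_below_mult[OF degree_below_ratio[OF assms(1-3)] degree_below_geom[OF assms]]
    by (rule degree_below_mono) simp
  ultimately show ?thesis
    using degree_below_ratio[OF assms(1-3)] by (simp add: degree_below_add)
qed

definition vert_weight :: "graph \<Rightarrow> weight" where
  "vert_weight G = (\<Prod>e \<in># G. vert (snd e))"

text \<open>The bound on \<open>vert_weight G\<close> is carried along because the induction
  multiplies this weight by the error term of the added edge.\<close>

lemma graph_weight_leading:
  assumes "finite S" "\<And>i j. (i, j) \<in># G \<Longrightarrow> i \<in> S \<and> j \<notin> S \<and> i < j"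
  shows "degree_below S 0 (vert_weight G) \<and> degree_below S (- 1) (graph_weight G - vert_weight G)"
  using assms(2)
proof (induction G)
  case empty
  then show ?case
    by (auto simp: degree_below_def graph_weight_def vert_weight_def src_degree_def)
next
  case (add e G)
  obtain i j where e: "e = (i, j)"
    by (cases e)
  then have ij: "i \<in> S" "j \<notin> S" "i < j"
    using add.prems by auto
  let ?m = "vert_weight G" and ?r = "graph_weight G - vert_weight G"
  let ?r' = "edge_weight i j - vert j"
  have m: "degree_below S 0 ?m" and r: "degree_below S (- 1) ?r"
    using add by auto
  have v: "degree_below S 0 (vert j)" and r': "degree_below S (- 1) ?r'"
    using degree_below_vert edge_weight_leading assms(1) ij by auto
  have "graph_weight (add_mset e G) - vert_weight (add_mset e G) = (vert j * ?r + ?r' * ?m) + ?r' * ?r"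
    by (simp add: e graph_weight_def vert_weight_def algebra_simps)
  moreover have "degree_below S (- 1) (vert j * ?r)" "degree_below S (- 1) (?r' * ?m)"
    using degree_below_mult[OF v r] degree_below_mult[OF r' m] by simp_all
  moreover have "degree_below S (- 1) (?r' * ?r)"
    using degree_below_mult[OF r' r] by (rule degree_below_mono) simp
  moreover have "vert_weight (add_mset e G) = vert j * ?m"
    by (simp add: e vert_weight_def)
  moreover have "degree_below S 0 (vert j * ?m)"
    using degree_below_mult[OF v m] by simp
  ultimately show ?case
    by (simp add: degree_below_add)
qed

text \<open>The exponents of the \<open>t_i\<close> and of the series variable in the product of the
  target vertices; the former are the indegrees.\<close>

definition in_monomial :: "graph \<Rightarrow> exponent \<times> nat" where
  "in_monomial G = (\<Sum>e \<in># G. Poly_Mapping.single (snd e) 1, \<Sum>e \<in># G. snd e)"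

lemma vert_weight_eq: "vert_weight G = monomial (fst (in_monomial G)) (snd (in_monomial G))"
  by (induction G) (auto simp: vert_weight_def in_monomial_def vert_def monomial_mult monomial_0)

lemma vert_weight_coeff:
  "Poly_Mapping.lookup (fps_nth (vert_weight G) w) d = (if in_monomial G = (d, w) then 1 else 0)"
  unfolding vert_weight_eq by (auto simp: monomial_nth lookup_single when_def prod_eq_iff)

lemma lookup_in_monomial: "Poly_Mapping.lookup (fst (in_monomial G)) i = int (indeg G i)"
  by (induction G) (auto simp: in_monomial_def indeg_def lookup_add lookup_single when_def)

lemma irreducible_graph_weight_coeff:
  assumes "graph_on n L" "irreducible_graph L" "\<And>i. Poly_Mapping.lookup d i \<ge> 0"
  shows "Poly_Mapping.lookup (fps_nth (graph_weight L) w) d = (if in_monomial L = (d, w) then 1 else 0)"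
proof -
  \<comment> \<open>The vertices without incoming edges: irreducibility puts every source into
    \<open>S\<close>, and no target belongs to it. The bound by \<open>n\<close> keeps
    \<open>S\<close> finite.\<close>
  define S where "S = {i. i \<le> n \<and> (\<forall>h. (h, i) \<notin># L)}"
  have "finite S"
    by (simp add: S_def)
  moreover have "i \<in> S \<and> j \<notin> S \<and> i < j" if ij: "(i, j) \<in># L" for i j
  proof -
    have on: "(a, b) \<in># L \<Longrightarrow> a < b \<and> b \<le> n" for a b
      using assms(1) by (auto simp: graph_on_def)
    have "(h, i) \<notin># L" for h
      using on[of h i] on[OF ij] ij assms(2) by (auto simp: irreducible_graph_def can_reduce_def)
    moreover have "i < j" "i \<le> n"
      using on[OF ij] by linarith+
    ultimately show ?thesis
      using ij unfolding S_def by blast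
  qed
  ultimately have "degree_below S (- 1) (graph_weight L - vert_weight L)"
    using graph_weight_leading by blast
  \<comment> \<open>Error terms have degree at most -1, so an exponent with nonnegative entries can
    only come from the leading monomial.\<close>
  moreover have "src_degree S d \<ge> 0"
    using assms(3) by (auto simp: src_degree_def intro: sum_nonneg)
  ultimately have "d \<notin> Poly_Mapping.keys (fps_nth (graph_weight L - vert_weight L) w)"
    by (force simp: degree_below_def)
  then have "Poly_Mapping.lookup (fps_nth (graph_weight L) w) d = Poly_Mapping.lookup (fps_nth (vert_weight L) w) d"
    by (simp add: in_keys_iff lookup_minus)
  then show ?thesis
    by (simp add: vert_weight_coeff)
qed

section \<open>Counting leaves through coefficients\<close>

lemma lookup_nth_sum_mset:
  "Poly_Mapping.lookup (fps_nth (\<Sum>x \<in># M. f x) w) d = (\<Sum>x \<in># M. Poly_Mapping.lookup (fps_nth (f x) w) d)"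
  by (induction M) (auto simp: lookup_add)

lemma sum_mset_if_eq: "(\<Sum>x \<in># M. if f x = y then 1 else 0) = int (count (image_mset f M) y)"
  by (induction M) auto

text \<open>The point is that the right-hand side does not mention \<open>t\<close>. The case split
  is there because the weight of \<open>G\<close> may have terms with negative exponents, whereas
  indegrees are never negative.\<close>

lemma in_monomial_leaves:
  assumes "graph_on n G" "partial_tree G t" "\<And>L. L \<in># leaves t \<Longrightarrow> irreducible_graph L"
  shows "int (count (image_mset in_monomial (leaves t)) (d, w)) =
    (if \<forall>i. Poly_Mapping.lookup d i \<ge> 0 then Poly_Mapping.lookup (fps_nth (graph_weight G) w) d else 0)"
proof (cases "\<forall>i. Poly_Mapping.lookup d i \<ge> 0")
  case True
  have "Poly_Mapping.lookup (fps_nth (graph_weight G) w) d = (\<Sum>L \<in># leaves t. Poly_Mapping.lookup (fps_nth (graph_weight L) w) d)"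
    using graph_weight_leaves[OF assms(2)] lookup_nth_sum_mset by metis
  also have "\<dots> = (\<Sum>L \<in># leaves t. if in_monomial L = (d, w) then 1 else 0)"
    using assms partial_tree_graph_on True
    by (intro arg_cong[where f = sum_mset] image_mset_cong irreducible_graph_weight_coeff) blast+
  also have "\<dots> = int (count (image_mset in_monomial (leaves t)) (d, w))"
    by (rule sum_mset_if_eq)
  finally show ?thesis
    using True by simp
next
  case False
  have "(d, w) \<notin># image_mset in_monomial (leaves t)"
  proof
    assume "(d, w) \<in># image_mset in_monomial (leaves t)"
    then obtain L where "(d, w) = in_monomial L" by auto
    then have "Poly_Mapping.lookup d i \<ge> 0" for i
      using lookup_in_monomial[of L i] by (metis fst_conv of_nat_0_le_iff)
    with False show False by blast
  qed
  then show ?thesis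
    using False by (simp only: not_in_iff if_False of_nat_0)
qed

text \<open>This carries equality of the monomial multisets over to the indegree sequences.\<close>

lemma InSeq_in_monomial:
  "InSeq n t = image_mset (\<lambda>m. map (\<lambda>i. nat (Poly_Mapping.lookup (fst m) i)) [1..<Suc n])
    (image_mset in_monomial (leaves t))"
  unfolding InSeq_def by (simp add: multiset.map_comp comp_def lookup_in_monomial)

lemma InSeq_unique:
  assumes "graph_on n G"
    and "partial_tree G t" "\<And>L. L \<in># leaves t \<Longrightarrow> irreducible_graph L"
    and "partial_tree G t'" "\<And>L. L \<in># leaves t' \<Longrightarrow> irreducible_graph L"
  shows "InSeq m t = InSeq m t'"
proof -
  have "image_mset in_monomial (leaves t) = image_mset in_monomial (leaves t')"
  proof (rule multiset_eqI)
    fix m :: "exponent \<times> nat"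
    show "count (image_mset in_monomial (leaves t)) m = count (image_mset in_monomial (leaves t')) m"
      using in_monomial_leaves[OF assms(1-3), of "fst m" "snd m"]
        in_monomial_leaves[OF assms(1,4,5), of "fst m" "snd m"] by simp
  qed
  then show ?thesis
    by (simp only: InSeq_in_monomial)
qed

theorem theoremA:
  fixes n :: nat and G :: graph and ord :: "nat \<Rightarrow> nat list" and R :: "graph rtree"
  assumes "graph_on n G"
    and "\<And>i. i \<in> {2..n} \<Longrightarrow> distinct (ord i) \<and> set (ord i) = in_vertices G i"
    and "reduction_tree G R"
  shows "LD ord n G = InSeq n R"
proof -
  \<comment> \<open>The special tree is thus a full reduction of \<open>G\<close>, so uniqueness
    applies to it and \<open>R\<close>.\<close>
  have "partial_tree G (special_tree ord G n) \<and>
      (\<forall>L \<in># leaves (special_tree ord G n). irreducible_graph L)"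
    using special_tree_reduces[OF assms(1), of n ord] assms(2) induced_self[OF assms(1)] by simp
  then show ?thesis
    unfolding LD_def using InSeq_unique[OF assms(1)] reduction_tree_partial_tree[OF assms(3)] by blast
qed

end
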